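(* Let $G$ be a finite digraph with vertex set $V$, let $t\ge 1$ be the activation threshold, and let $S\subseteq V$ with $|S|=s$. (a) Suppose $s\ge t$. Then $G$ cannot be synchronized starting from $S$ (with threshold $t$) if and only if there exists a set $A$ of vertices acquired from $S$, with $S\subseteq A\neq V$, such that $\mathrm{id}_A x<t$ for all $x\in V\setminus A$. (b) Suppose moreover that $G$ is regular of degree $h$ with $h\ge t$ and $s\ge t$. Then $G$ cannot be synchronized starting from $S$ if and only if there exists a set $A$ of vertices acquired from $S$, with $S\subseteq A\neq V$, such that $\mathrm{id}_{V\setminus A}\, x>h-t$ for all $x\in V\setminus A$.
   Context: Activation process: given a digraph $G$ with vertex set $V$, a set $S\subseteq V$ of initially active vertices and a natural number $t$ (the threshold), put $S_0=S$ and for $i\ge1$ let $S_i=S_{i-1}\cup\{v\in V\setminus S_{i-1}: v \text{ has at least } t \text{ edges } (u,v) \text{ with } u\in S_{i-1}\}$. A vertex $x$ is acquired from $S$ if $x\in S_i$ for some $i\ge 0$. $G$ is synchronized (brought to synchrony) starting from $S$ if $S_i=V$ for some $i$. For $U\subseteq V$ and a vertex $x$, $\mathrm{id}_U x$ denotes the number of edges that originate in $U$ and point to $x$. A digraph is regular of degree $h$ if every vertex has in-degree $h$ and out-degree $h$. *)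

theory Defs
  imports "Graph_Theory.Digraph"
begin

text \<open>Arcs, not source vertices, are counted, so parallel arcs count with multiplicity
  and a loop at \<open>x\<close> counts whenever \<open>x \<in> U\<close>.\<close>

definition in_degree_from :: "('a, 'b) pre_digraph \<Rightarrow> 'a set \<Rightarrow> 'a \<Rightarrow> nat" where
  "in_degree_from G U x = card {e \<in> in_arcs G x. tail G e \<in> U}"

primrec activation :: "('a, 'b) pre_digraph \<Rightarrow> nat \<Rightarrow> 'a set \<Rightarrow> nat \<Rightarrow> 'a set" where
  "activation G t S 0 = S"
| "activation G t S (Suc i) = activation G t S i \<union>
     {v \<in> verts G - activation G t S i. t \<le> in_degree_from G (activation G t S i) v}"

definition acquired :: "('a, 'b) pre_digraph \<Rightarrow> nat \<Rightarrow> 'a set \<Rightarrow> 'a \<Rightarrow> bool" where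
  "acquired G t S x \<longleftrightarrow> (\<exists>i. x \<in> activation G t S i)"

definition synchronized_from :: "('a, 'b) pre_digraph \<Rightarrow> nat \<Rightarrow> 'a set \<Rightarrow> bool" where
  "synchronized_from G t S \<longleftrightarrow> (\<exists>i. activation G t S i = verts G)"

definition regular_digraph :: "('a, 'b) pre_digraph \<Rightarrow> nat \<Rightarrow> bool" where
  "regular_digraph G h \<longleftrightarrow> (\<forall>v \<in> verts G. in_degree G v = h \<and> out_degree G v = h)"

end

theory Submission
  imports Defs
begin

text \<open>The activation process is an increasing chain of subsets of a finite vertex set, so it reaches
  a fixed point, which is a witness \<open>A\<close> if it is not the whole vertex set. Conversely the process
  never leaves a set \<open>A \<supseteq> S\<close> from which every outside vertex receives fewer than \<open>t\<close> arcs. In the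
  regular case the \<open>h\<close> arcs into a vertex split into those from \<open>A\<close> and those from outside \<open>A\<close>.\<close>

lemma activation_subset_verts: "S \<subseteq> verts G \<Longrightarrow> activation G t S i \<subseteq> verts G"
  by (induction i) auto

lemma activation_mono: "i \<le> j \<Longrightarrow> activation G t S i \<subseteq> activation G t S j"
  by (rule lift_Suc_mono_le[of "activation G t S"]) auto

context fin_digraph
begin

lemma in_degree_from_mono:
  assumes "U \<subseteq> W"
  shows "in_degree_from G U x \<le> in_degree_from G W x"
  unfolding in_degree_from_def
  by (rule card_mono) (use assms in auto)

text \<open>Every arc into \<open>x\<close> has its tail in \<open>verts G\<close> by
  well-formedness, so splitting by whether the tail lies in \<open>U\<close> covers all of
  \<open>in_arcs G x\<close>.\<close>

lemma in_degree_from_add_compl: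
  "in_degree_from G U x + in_degree_from G (verts G - U) x = in_degree G x"
proof -
  let ?A = "{e \<in> in_arcs G x. tail G e \<in> U}" and ?B = "{e \<in> in_arcs G x. tail G e \<in> verts G - U}"
  have "card ?A + card ?B = card (?A \<union> ?B)"
    by (rule card_Un_disjoint[symmetric]) auto
  also have "?A \<union> ?B = in_arcs G x"
    by auto
  finally show ?thesis
    by (simp add: in_degree_from_def in_degree_def)
qed

text \<open>Cardinalities of stages are bounded by \<open>card (verts G)\<close>, so some stage
  \<open>i\<close> has the largest one; in an increasing chain it contains all others.\<close>

lemma activation_stabilizes:
  assumes "S \<subseteq> verts G"
  obtains i where "\<And>j. activation G t S j \<subseteq> activation G t S i"
proof -
  have "card (activation G t S j) < Suc (card (verts G))" for j
    using card_mono[OF finite_verts activation_subset_verts[OF assms]] by (simp add: less_Suc_eq_le)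
  then obtain i where i: "\<And>j. card (activation G t S j) \<le> card (activation G t S i)"
    using ex_has_greatest_nat[of "\<lambda>_. True" 0 "\<lambda>j. card (activation G t S j)" "Suc (card (verts G))"]
    by (metis less_imp_le)
  have "activation G t S j \<subseteq> activation G t S i" for j
  proof -
    have "finite (activation G t S (max i j))"
      using activation_subset_verts[OF assms] finite_verts by (rule finite_subset)
    \<comment> \<open>Stage \<open>max i j\<close> contains stage \<open>i\<close> and is no larger,
      by the choice of \<open>i\<close>.\<close>
    then have "activation G t S i = activation G t S (max i j)"
      using i by (intro card_seteq activation_mono) auto
    then show ?thesis
      using activation_mono[OF max.cobounded2] by simp
  qed
  then show thesis by (rule that)
qed

text \<open>A vertex with \<open>t\<close> arcs from a stage inside \<open>A\<close> has at least
  \<open>t\<close> arcs from \<open>A\<close>, so it cannot lie outside \<open>A\<close>.\<close>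

lemma activation_subset_closed:
  assumes "S \<subseteq> A" "\<forall>x\<in>verts G - A. in_degree_from G A x < t"
  shows "activation G t S i \<subseteq> A"
proof (induction i)
  case (Suc i)
  have "x \<in> A" if "x \<in> verts G" "t \<le> in_degree_from G (activation G t S i) x" for x
    using that in_degree_from_mono[OF Suc, of x] assms(2) by force
  then show ?case
    using Suc by auto
qed (use assms in simp)

lemma not_synchronized_from_iff:
  assumes S: "S \<subseteq> verts G"
  shows "\<not> synchronized_from G t S \<longleftrightarrow>
    (\<exists>A. A \<subseteq> verts G \<and> (\<forall>x\<in>A. acquired G t S x) \<and> S \<subseteq> A \<and> A \<noteq> verts G \<and>
         (\<forall>x\<in>verts G - A. in_degree_from G A x < t))"
    (is "?L \<longleftrightarrow> ?R")
proof
  assume ns: ?L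
  obtain i where i: "\<And>j. activation G t S j \<subseteq> activation G t S i"
    using activation_stabilizes[OF S] by blast
  \<comment> \<open>Otherwise \<open>x\<close> would enter at stage \<open>Suc i\<close>, which adds
    nothing to stage \<open>i\<close>.\<close>
  have "in_degree_from G (activation G t S i) x < t" if "x \<in> verts G - activation G t S i" for x
    using that i[of "Suc i"] by (auto simp: not_le[symmetric])
  moreover have "activation G t S i \<noteq> verts G"
    using ns by (auto simp: synchronized_from_def)
  ultimately show ?R
    using activation_subset_verts[OF S] i[of 0]
    by (intro exI[of _ "activation G t S i"]) (auto simp: acquired_def)
next
  assume ?R
  then obtain A where "A \<subseteq> verts G" "A \<noteq> verts G" "\<And>i. activation G t S i \<subseteq> A"
    using activation_subset_closed by metis
  then show ?L
    unfolding synchronized_from_def by (metis subset_antisym)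
qed

text \<open>The two counts sum to \<open>h\<close>; \<open>t \<le> h\<close> keeps the
  natural-number difference \<open>h - t\<close> from being truncated.\<close>

lemma in_degree_from_less_iff_compl:
  assumes "in_degree G x = h" "t \<le> h"
  shows "in_degree_from G A x < t \<longleftrightarrow> h - t < in_degree_from G (verts G - A) x"
  using in_degree_from_add_compl[of A x] assms by linarith

end

theorem theorem1:
  fixes G :: "('a, 'b) pre_digraph" and S :: "'a set" and s t h :: nat
  assumes "fin_digraph G"
    and "t \<ge> 1"
    and "S \<subseteq> verts G"
    and "card S = s"
  shows
    "(s \<ge> t \<longrightarrow>
        (\<not> synchronized_from G t S \<longleftrightarrow>
          (\<exists>A. A \<subseteq> verts G \<and> (\<forall>x\<in>A. acquired G t S x) \<and> S \<subseteq> A \<and> A \<noteq> verts G \<and>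
               (\<forall>x\<in>verts G - A. in_degree_from G A x < t))))
   \<and> (regular_digraph G h \<and> h \<ge> t \<and> s \<ge> t \<longrightarrow>
        (\<not> synchronized_from G t S \<longleftrightarrow>
          (\<exists>A. A \<subseteq> verts G \<and> (\<forall>x\<in>A. acquired G t S x) \<and> S \<subseteq> A \<and> A \<noteq> verts G \<and>
               (\<forall>x\<in>verts G - A. in_degree_from G (verts G - A) x > h - t))))"
proof -
  interpret fin_digraph G by fact
  note a = not_synchronized_from_iff[OF \<open>S \<subseteq> verts G\<close>, of t]
  \<comment> \<open>The two conditions agree for each \<open>A\<close>, so the same witnesses serve
    both parts.\<close>
  have "(\<forall>x\<in>verts G - A. in_degree_from G A x < t) \<longleftrightarrow>
      (\<forall>x\<in>verts G - A. in_degree_from G (verts G - A) x > h - t)"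
    if "regular_digraph G h" "h \<ge> t" for A
    using that in_degree_from_less_iff_compl unfolding regular_digraph_def by (intro ball_cong) auto
  with a show ?thesis by simp
qed

end
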